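(* Let $G=(V,E)$ be a finite undirected graph with $p=|V|$ vertices, and let $\sigma: V\to\{1,\dots,p\}$ be an ordering of its vertices (a bijection). Then the following statements are equivalent. 1. $G$ is a homogeneous graph and $\sigma$ is a Hasse tree based elimination scheme for $G$. 2. For every $p\times p$ diagonal matrix $D$ with positive diagonal entries and every $p\times p$ real lower triangular matrix $L$ with unit diagonal entries, $$L\in\mathcal{L}_{G_\sigma}\iff L^{-1}\in\mathcal{L}_{G_\sigma}\iff \Sigma:=LDL^T\in P_{G_\sigma}.$$ 3. For every $\Sigma\in P_{G_\sigma}$ with modified Cholesky decomposition $\Sigma=LDL^T$, and for every maximal clique $C$ of $G$, $$\left|(\Sigma^{-1})_{\sigma(C)}\right|=\prod_{i\in\sigma(C)}\frac{1}{D_{ii}}.$$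
   Context: Graphs are finite, undirected and without loops: $E\subseteq V\times V$ is symmetric, i.e. $(u,v)\in E\iff (v,u)\in E$. All matrices are real. A clique is a set of pairwise adjacent vertices; a maximal clique is a clique not properly contained in another clique. For $v\in V$ write $N[v]=\{u\in V: u=v \text{ or } (u,v)\in E\}$. The graph $G$ is homogeneous if for all $v,v'$ with $(v,v')\in E$, either $N[v']\subseteq N[v]$ or $N[v]\subseteq N[v']$. (Equivalently, $G$ has no induced cycle on 4 or more vertices and no induced path on 4 vertices. $G$ need not be connected.) Write $v\to w$ whenever $N[w]\subseteq N[v]$. Define the equivalence relation $R$ on $V$ by $uRv\iff (u\to v \text{ and } v\to u)$, and let $\bar v$ denote the $R$-class of $v$. If $G$ is homogeneous, an ordering $\sigma$ of $V$ is a Hasse tree based elimination scheme for $G$ if for every pair of vertices $u,v$: $u\to v$ and $\bar u\neq\bar v$ imply $\sigma(u)>\sigma(v)$. $P_{G_\sigma}$ is the set of $p\times p$ symmetric positive definite matrices $\Sigma$ such that $\Sigma_{ij}=0$ whenever $i\ne j$ and $(\sigma^{-1}(i),\sigma^{-1}(j))\notin E$. $\mathcal{L}_{G_\sigma}$ is the set of $p\times p$ lower triangular matrices $L$ with $L_{ii}=1$ for all $i$, and $L_{ij}=0$ whenever $i>j$ and $(\sigma^{-1}(i),\sigma^{-1}(j))\notin E$. The modified Cholesky decomposition of a positive definite $\Sigma$ is the unique factorization $\Sigma=LDL^T$ with $L$ lower triangular with unit diagonal entries and $D$ diagonal with positive diagonal entries $D_{ii}$. For a $p \times p$ matrix $A$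 and $M\subseteq\{1,\dots,p\}$, $A_M=(A_{ij})_{i,j\in M}$ is the principal submatrix, and $|A_M|$ is its determinant. $\sigma(C)=\{\sigma(u):u\in C\}$. *)

theory Defs
  imports
    "Jordan_Normal_Form.Determinant"
    "Jordan_Normal_Form.Gauss_Jordan_Elimination"
    "Jordan_Normal_Form.DL_Submatrix"
    "Graph_Theory.Pair_Digraph"
begin

definition lower_triangular :: "'a::zero mat \<Rightarrow> bool" where
  "lower_triangular A \<longleftrightarrow> (\<forall>i<dim_row A. \<forall>j<dim_col A. i < j \<longrightarrow> A $$ (i, j) = 0)"

definition unit_lower_triangular :: "nat \<Rightarrow> real mat \<Rightarrow> bool" where
  "unit_lower_triangular p L \<longleftrightarrow>
     L \<in> carrier_mat p p \<and> lower_triangular L \<and> (\<forall>i<p. L $$ (i, i) = 1)"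

definition pos_diagonal :: "nat \<Rightarrow> real mat \<Rightarrow> bool" where
  "pos_diagonal p D \<longleftrightarrow>
     D \<in> carrier_mat p p \<and> diagonal_mat D \<and> (\<forall>i<p. D $$ (i, i) > 0)"

definition sym_pos_definite :: "nat \<Rightarrow> real mat \<Rightarrow> bool" where
  "sym_pos_definite p A \<longleftrightarrow>
     A \<in> carrier_mat p p \<and> A\<^sup>T = A \<and>
     (\<forall>x\<in>carrier_vec p. x \<noteq> 0\<^sub>v p \<longrightarrow> x \<bullet> (A *\<^sub>v x) > 0)"

definition modified_cholesky :: "nat \<Rightarrow> real mat \<Rightarrow> real mat \<Rightarrow> real mat \<Rightarrow> bool" where
  "modified_cholesky p S L D \<longleftrightarrow>
     unit_lower_triangular p L \<and> pos_diagonal p D \<and> S = L * D * L\<^sup>T"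

text \<open>Unspecified for singular matrices, where \<open>mat_inverse\<close> returns \<open>None\<close>.\<close>

definition mat_inv :: "'a::field mat \<Rightarrow> 'a mat" where
  "mat_inv A = the (mat_inverse A)"

lemma mat_inv:
  fixes A :: "'a::field mat"
  assumes A: "A \<in> carrier_mat n n" and det: "det A \<noteq> 0"
  shows "mat_inv A \<in> carrier_mat n n" "A * mat_inv A = 1\<^sub>m n" "mat_inv A * A = 1\<^sub>m n"
proof -
  have "A \<in> Units (ring_mat TYPE('a) n ())"
    using det_non_zero_imp_unit[OF A det] .
  with mat_inverse(1)[OF A, of "()"] obtain B where B: "mat_inverse A = Some B"
    by (cases "mat_inverse A") auto
  from mat_inverse(2)[OF A B] B
  show "mat_inv A \<in> carrier_mat n n" "A * mat_inv A = 1\<^sub>m n" "mat_inv A * A = 1\<^sub>m n"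
    by (simp_all add: mat_inv_def)
qed

definition clique :: "'v pair_pre_digraph \<Rightarrow> 'v set \<Rightarrow> bool" where
  "clique G C \<longleftrightarrow>
     C \<subseteq> pverts G \<and> (\<forall>u\<in>C. \<forall>v\<in>C. u \<noteq> v \<longrightarrow> (u, v) \<in> parcs G)"

definition maximal_clique :: "'v pair_pre_digraph \<Rightarrow> 'v set \<Rightarrow> bool" where
  "maximal_clique G C \<longleftrightarrow> clique G C \<and> \<not> (\<exists>C'. clique G C' \<and> C \<subset> C')"

definition closed_nbhd :: "'v pair_pre_digraph \<Rightarrow> 'v \<Rightarrow> 'v set" where
  "closed_nbhd G v = {u \<in> pverts G. u = v \<or> (u, v) \<in> parcs G}"

definition homogeneous :: "'v pair_pre_digraph \<Rightarrow> bool" where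
  "homogeneous G \<longleftrightarrow>
     (\<forall>(v, v')\<in>parcs G. closed_nbhd G v' \<subseteq> closed_nbhd G v \<or> closed_nbhd G v \<subseteq> closed_nbhd G v')"

text \<open>\<open>above G v w\<close> is the relation \<open>v \<rightarrow> w\<close>, and \<open>nbhd_class G v\<close> the class of \<open>v\<close> under
  the induced equivalence relation.\<close>

definition above :: "'v pair_pre_digraph \<Rightarrow> 'v \<Rightarrow> 'v \<Rightarrow> bool" where
  "above G v w \<longleftrightarrow> closed_nbhd G w \<subseteq> closed_nbhd G v"

definition nbhd_equiv :: "'v pair_pre_digraph \<Rightarrow> 'v rel" where
  "nbhd_equiv G = {(u, v). u \<in> pverts G \<and> v \<in> pverts G \<and> above G u v \<and> above G v u}"

definition nbhd_class :: "'v pair_pre_digraph \<Rightarrow> 'v \<Rightarrow> 'v set" where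
  "nbhd_class G v = nbhd_equiv G `` {v}"

definition hasse_tree_elim_scheme :: "'v pair_pre_digraph \<Rightarrow> ('v \<Rightarrow> nat) \<Rightarrow> bool" where
  "hasse_tree_elim_scheme G \<sigma> \<longleftrightarrow>
     (\<forall>u\<in>pverts G. \<forall>v\<in>pverts G.
        above G u v \<and> nbhd_class G u \<noteq> nbhd_class G v \<longrightarrow> \<sigma> u > \<sigma> v)"

text \<open>Since matrices are indexed from 0, an ordering of the vertices is a bijection onto
  \<open>{0, ..., p - 1}\<close> rather than onto \<open>{1, ..., p}\<close>.\<close>

definition vertex_ordering :: "'v pair_pre_digraph \<Rightarrow> ('v \<Rightarrow> nat) \<Rightarrow> bool" where
  "vertex_ordering G \<sigma> \<longleftrightarrow> bij_betw \<sigma> (pverts G) {..<card (pverts G)}"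

definition adj_at :: "'v pair_pre_digraph \<Rightarrow> ('v \<Rightarrow> nat) \<Rightarrow> nat \<Rightarrow> nat \<Rightarrow> bool" where
  "adj_at G \<sigma> i j \<longleftrightarrow>
     (inv_into (pverts G) \<sigma> i, inv_into (pverts G) \<sigma> j) \<in> parcs G"

definition P_cone :: "'v pair_pre_digraph \<Rightarrow> ('v \<Rightarrow> nat) \<Rightarrow> real mat set" where
  "P_cone G \<sigma> = (let p = card (pverts G) in
     {S. sym_pos_definite p S \<and>
         (\<forall>i<p. \<forall>j<p. i \<noteq> j \<and> \<not> adj_at G \<sigma> i j \<longrightarrow> S $$ (i, j) = 0)})"

definition L_space :: "'v pair_pre_digraph \<Rightarrow> ('v \<Rightarrow> nat) \<Rightarrow> real mat set" where
  "L_space G \<sigma> = (let p = card (pverts G) in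
     {L. unit_lower_triangular p L \<and>
         (\<forall>i<p. \<forall>j<p. i > j \<and> \<not> adj_at G \<sigma> i j \<longrightarrow> L $$ (i, j) = 0)})"

abbreviation principal_submatrix :: "'a mat \<Rightarrow> nat set \<Rightarrow> 'a mat" where
  "principal_submatrix A M \<equiv> submatrix A M M"

end

theory Submission
  imports Defs
begin

text \<open>All three statements are equivalent to the nestedness condition: \<open>N[v] \<subseteq> N[u]\<close> whenever
  \<open>u, v\<close> are adjacent and \<open>\<sigma> v < \<sigma> u\<close>. Nestedness makes the support pattern of \<open>L\<close> a
  transitive relation, hence stable under inversion, and \<open>\<sigma>\<close> a perfect elimination ordering, so that
  \<open>\<Sigma> = LDL\<^sup>T\<close> has the prescribed zeros iff \<open>L\<close> does. Conversely, each failure of nestedness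
  is detected by a matrix \<open>L\<close> with two nonzero entries below the diagonal and \<open>D = I\<close>. For the
  determinants, put \<open>M = L\<^sup>-\<^sup>1\<close>, so that \<open>\<Sigma>\<^sup>-\<^sup>1 = M\<^sup>T D\<^sup>-\<^sup>1 M\<close>: under nestedness the
  columns of \<open>M\<close> indexed by a maximal clique vanish outside the clique, and the principal minor
  factorizes. If \<open>w \<in> N[v] - N[u]\<close>, a maximal clique containing \<open>v, w\<close> misses \<open>u\<close>, and
  \<open>L = I + E\<^sub>u\<^sub>v\<close>, \<open>D = I\<close> violates the determinant formula.\<close>

section \<open>Triangular factorizations\<close>

lemma mult_entry:
  assumes "A \<in> carrier_mat n m" "B \<in> carrier_mat m q" "i < n" "j < q"
  shows "(A * B) $$ (i, j) = (\<Sum>k<m. A $$ (i, k) * B $$ (k, j))"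
  using assms by (auto simp: scalar_prod_def atLeast0LessThan)

lemma congruence_entry:
  fixes A D :: "'a::comm_semiring_1 mat"
  assumes A: "A \<in> carrier_mat n p" and D: "D \<in> carrier_mat p p" "diagonal_mat D"
    and "i < n" "j < n"
  shows "(A * D * A\<^sup>T) $$ (i, j) = (\<Sum>k<p. A $$ (i, k) * D $$ (k, k) * A $$ (j, k))"
proof -
  have AD: "(A * D) $$ (i, k) = A $$ (i, k) * D $$ (k, k)" if "k < p" for k
  proof -
    have "(A * D) $$ (i, k) = (\<Sum>l<p. A $$ (i, l) * D $$ (l, k))"
      using A D(1) \<open>i < n\<close> that by (rule mult_entry)
    also have "\<dots> = (\<Sum>l\<in>{k}. A $$ (i, l) * D $$ (l, k))"
      using D that by (intro sum.mono_neutral_right) (auto simp: diagonal_mat_def)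
    finally show ?thesis by simp
  qed
  have "(A * D * A\<^sup>T) $$ (i, j) = (\<Sum>k<p. (A * D) $$ (i, k) * A\<^sup>T $$ (k, j))"
    using assms by (intro mult_entry) auto
  also have "\<dots> = (\<Sum>k<p. A $$ (i, k) * D $$ (k, k) * A $$ (j, k))"
    using AD assms by (intro sum.cong) auto
  finally show ?thesis .
qed

lemma unit_lower_triangularD:
  assumes "unit_lower_triangular p L"
  shows "L \<in> carrier_mat p p" "i < p \<Longrightarrow> L $$ (i, i) = 1"
    "i < j \<Longrightarrow> j < p \<Longrightarrow> L $$ (i, j) = 0"
  using assms by (auto simp: unit_lower_triangular_def lower_triangular_def)

lemma pos_diagonalD:
  assumes "pos_diagonal p D"
  shows "D \<in> carrier_mat p p" "diagonal_mat D" "i < p \<Longrightarrow> D $$ (i, i) > 0"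
  using assms by (auto simp: pos_diagonal_def)

lemma det_lower_triangular_prod:
  assumes "A \<in> carrier_mat n n" "\<And>i j. i < j \<Longrightarrow> j < n \<Longrightarrow> A $$ (i, j) = 0"
  shows "det A = (\<Prod>i<n. A $$ (i, i))"
  using det_lower_triangular[of n A] assms by (simp add: prod_list_diag_prod atLeast0LessThan)

lemma det_diagonal:
  assumes "D \<in> carrier_mat n n" "diagonal_mat D"
  shows "det D = (\<Prod>i<n. D $$ (i, i))"
  using assms by (intro det_lower_triangular_prod) (auto simp: diagonal_mat_def)

lemma det_unit_lower_triangular:
  assumes "unit_lower_triangular p L"
  shows "det L = 1"
  using det_lower_triangular_prod[of L p] unit_lower_triangularD[OF assms] by simp

section \<open>Inverses of unit lower triangular matrices\<close>

text \<open>A right inverse suffices: \<open>det A * det B = 1\<close> makes \<open>A\<close>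
  nonsingular, so \<open>mat_inv A\<close> is specified.\<close>

lemma mat_inv_eqI:
  fixes A B :: "'a::field mat"
  assumes A: "A \<in> carrier_mat n n" and B: "B \<in> carrier_mat n n" and AB: "A * B = 1\<^sub>m n"
  shows "mat_inv A = B"
proof -
  have "det A * det B = 1"
    using det_mult[OF A B] AB by simp
  then have d: "det A \<noteq> 0" by auto
  have "mat_inv A = mat_inv A * (A * B)"
    using mat_inv(1)[OF A d] AB by simp
  also have "\<dots> = (mat_inv A * A) * B"
    using mat_inv(1)[OF A d] A B by simp
  also have "\<dots> = B"
    using mat_inv(3)[OF A d] B by simp
  finally show ?thesis .
qed

text \<open>Off the diagonal, entry \<open>(i, j)\<close> of \<open>M * L = 1\<close> expresses
  \<open>M $$ (i, j)\<close> through products \<open>M $$ (i, k) * L $$ (k, j)\<close> with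
  \<open>k > j\<close>. A nonzero entry thus yields a chain \<open>R i k\<close>,
  \<open>R k j\<close>, by induction from the last column downwards. Taking \<open>R\<close> to be
  \<open>(\<ge>)\<close> gives triangularity of the inverse; taking the graph pattern gives its
  zeros.\<close>

lemma inverse_support:
  assumes L: "unit_lower_triangular p L" and M: "M \<in> carrier_mat p p" and inv: "M * L = 1\<^sub>m p"
    and R: "reflp R" "transp R"
    and supp: "\<And>i j. i < p \<Longrightarrow> j < p \<Longrightarrow> L $$ (i, j) \<noteq> 0 \<Longrightarrow> R i j"
    and ij: "i < p" "j < p" "M $$ (i, j) \<noteq> 0"
  shows "R i j"
  using ij(2,3)
proof (induction "p - j" arbitrary: j rule: less_induct)
  case less
  show ?case
  proof (cases "i = j")
    case True
    with R(1) show ?thesis by (simp add: reflpD)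
  next
    case False
    have "0 = (M * L) $$ (i, j)"
      using inv False less.prems ij(1) by simp
    also have "\<dots> = (\<Sum>k<p. M $$ (i, k) * L $$ (k, j))"
      using M unit_lower_triangularD(1)[OF L] ij(1) less.prems(1) by (rule mult_entry)
    also have "\<dots> = M $$ (i, j) + (\<Sum>k\<in>{..<p} - {j}. M $$ (i, k) * L $$ (k, j))"
      using less.prems unit_lower_triangularD(2)[OF L] by (subst sum.remove[of _ j]) auto
    finally have "(\<Sum>k\<in>{..<p} - {j}. M $$ (i, k) * L $$ (k, j)) \<noteq> 0"
      using less.prems by auto
    then obtain k where k: "k < p" "k \<noteq> j" "M $$ (i, k) \<noteq> 0" "L $$ (k, j) \<noteq> 0"
      by (metis (no_types, lifting) DiffE insertI1 lessThan_iff mult_eq_0_iff sum.neutral)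
    with unit_lower_triangularD(3)[OF L, of k j] less.prems have "j < k"
      by (meson linorder_neqE_nat)
    with k less.prems less.hyps[of k] have "R i k" by auto
    moreover have "R k j" using supp k less.prems by blast
    ultimately show ?thesis using R(2) by (meson transpD)
  qed
qed

lemma mat_inv_unit_lower_triangular:
  assumes "unit_lower_triangular p L"
  shows "mat_inv L \<in> carrier_mat p p" "L * mat_inv L = 1\<^sub>m p" "mat_inv L * L = 1\<^sub>m p"
  using mat_inv[of L p] unit_lower_triangularD(1)[OF assms] det_unit_lower_triangular[OF assms]
  by auto

lemma unit_lower_triangular_mat_inv:
  assumes L: "unit_lower_triangular p L"
  shows "unit_lower_triangular p (mat_inv L)"
proof -
  let ?M = "mat_inv L"
  note M = mat_inv_unit_lower_triangular[OF L]
  have low: "i \<ge> j" if "i < p" "j < p" "?M $$ (i, j) \<noteq> 0" for i j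
    using L M(1,3) _ _ _ that
    by (rule inverse_support[where R = "(\<ge>)"])
      (use unit_lower_triangularD[OF L] in \<open>auto simp: reflp_def transp_def intro: leI\<close>)
  have diag: "?M $$ (i, i) = 1" if "i < p" for i
  proof -
    have "1 = (?M * L) $$ (i, i)" using M that by simp
    also have "\<dots> = (\<Sum>k<p. ?M $$ (i, k) * L $$ (k, i))"
      using M(1) unit_lower_triangularD(1)[OF L] that that by (rule mult_entry)
    \<comment> \<open>Row \<open>i\<close> of \<open>?M\<close> lives in columns
      \<open>k \<le> i\<close> and column \<open>i\<close> of \<open>L\<close> in rows
      \<open>k \<ge> i\<close>.\<close>
    also have "\<dots> = (\<Sum>k\<in>{i}. ?M $$ (i, k) * L $$ (k, i))"
      using that low[of i] unit_lower_triangularD(3)[OF L, of _ i]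
      by (intro sum.mono_neutral_right) (auto, meson le_antisym linorder_not_le)
    finally show ?thesis using unit_lower_triangularD(2)[OF L] that by simp
  qed
  have "?M $$ (i, j) = 0" if "i < j" "j < p" for i j
    using low[of i j] that by (meson leD less_trans)
  with M(1) diag show ?thesis
    by (auto simp: unit_lower_triangular_def lower_triangular_def)
qed

lemma mat_inv_mat_inv:
  assumes "unit_lower_triangular p L"
  shows "mat_inv (mat_inv L) = L"
  using mat_inv_eqI mat_inv_unit_lower_triangular[OF assms] unit_lower_triangularD(1)[OF assms]
  by blast

section \<open>Positive definiteness and inverse of \<open>L * D * L\<^sup>T\<close>\<close>

text \<open>The substitution \<open>y = L\<^sup>T *\<^sub>v x\<close> turns the quadratic form into
  a positively weighted sum of squares, and \<open>y\<close> is nonzero because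
  \<open>det L = 1\<close>.\<close>

lemma sym_pos_definite_cholesky:
  assumes L: "unit_lower_triangular p L" and D: "pos_diagonal p D"
  shows "sym_pos_definite p (L * D * L\<^sup>T)"
proof -
  note Lc = unit_lower_triangularD(1)[OF L] and Dc = pos_diagonalD[OF D]
  let ?S = "L * D * L\<^sup>T"
  have S: "?S \<in> carrier_mat p p" using Lc Dc by simp
  have "?S\<^sup>T = ?S"
    using S Lc Dc congruence_entry[OF Lc Dc(1,2)]
    by (intro eq_matI) (auto simp del: index_mult_mat(1) simp: mult_ac)
  moreover have "x \<bullet> (?S *\<^sub>v x) > 0" if x: "x \<in> carrier_vec p" "x \<noteq> 0\<^sub>v p" for x
  proof -
    define y where "y = L\<^sup>T *\<^sub>v x"
    have y: "y \<in> carrier_vec p" using Lc x by (simp add: y_def)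
    have "y \<noteq> 0\<^sub>v p"
      using det_0_iff_vec_prod_zero[of "L\<^sup>T" p] det_transpose[OF Lc] det_unit_lower_triangular[OF L]
        Lc x by (auto simp: y_def)
    then obtain k where k: "k < p" "y $ k \<noteq> 0"
      using y by (metis carrier_vecD eq_vecI index_zero_vec)
    have Dy: "(D *\<^sub>v y) $ i = D $$ (i, i) * y $ i" if "i < p" for i
    proof -
      have "(D *\<^sub>v y) $ i = (\<Sum>l<p. D $$ (i, l) * y $ l)"
        using Dc y that by (auto simp: scalar_prod_def atLeast0LessThan)
      also have "\<dots> = (\<Sum>l\<in>{i}. D $$ (i, l) * y $ l)"
        using Dc that by (intro sum.mono_neutral_right) (auto simp: diagonal_mat_def)
      finally show ?thesis by simp
    qed
    have "?S *\<^sub>v x = L *\<^sub>v (D *\<^sub>v y)"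
      using Lc Dc x y by (simp add: y_def assoc_mult_mat_vec[of _ p p _ p])
    then have "x \<bullet> (?S *\<^sub>v x) = y \<bullet> (D *\<^sub>v y)"
      using transpose_vec_mult_scalar[of L p p "D *\<^sub>v y" x] Lc Dc x y
      by (simp add: y_def)
    also have "\<dots> = (\<Sum>i<p. D $$ (i, i) * (y $ i)\<^sup>2)"
      using Dc y Dy by (auto simp: scalar_prod_def atLeast0LessThan power2_eq_square mult_ac
          simp del: index_mult_mat_vec intro!: sum.cong)
    also have "\<dots> > 0"
      using k Dc(3) by (intro sum_pos2[of _ k]) (auto simp: less_imp_le)
    finally show ?thesis .
  qed
  ultimately show ?thesis using S by (auto simp: sym_pos_definite_def)
qed

lemma mat_inv_cholesky:
  assumes L: "unit_lower_triangular p L" and D: "pos_diagonal p D"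
  shows mat_inv_cholesky_carrier: "mat_inv (L * D * L\<^sup>T) \<in> carrier_mat p p" (is ?carrier)
    and mat_inv_cholesky_entry: "i < p \<Longrightarrow> j < p \<Longrightarrow> mat_inv (L * D * L\<^sup>T) $$ (i, j) =
      (\<Sum>k<p. mat_inv L $$ (k, i) * (1 / D $$ (k, k)) * mat_inv L $$ (k, j))"
      (is "_ \<Longrightarrow> _ \<Longrightarrow> ?entry")
proof -
  note Lc = unit_lower_triangularD(1)[OF L] and Dc = pos_diagonalD[OF D]
  define M where "M = mat_inv L"
  note M = mat_inv_unit_lower_triangular[OF L, folded M_def]
  \<comment> \<open>\<open>E\<close> is the inverse of \<open>D\<close>; the claim becomes that the
    inverse is \<open>M\<^sup>T * E * M\<close>.\<close>
  define E where "E = mat p p (\<lambda>(i, j). if i = j then 1 / D $$ (i, i) else 0)"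
  have E: "E \<in> carrier_mat p p" "diagonal_mat E" by (auto simp: E_def diagonal_mat_def)
  have DE: "D * E = 1\<^sub>m p"
  proof (rule eq_matI)
    fix i j assume "i < dim_row (1\<^sub>m p :: real mat)" "j < dim_col (1\<^sub>m p :: real mat)"
    then have ij: "i < p" "j < p" by auto
    have "(D * E) $$ (i, j) = (\<Sum>k<p. D $$ (i, k) * E $$ (k, j))"
      using Dc(1) E(1) ij by (rule mult_entry)
    also have "\<dots> = (\<Sum>k\<in>{i}. D $$ (i, k) * E $$ (k, j))"
      using Dc ij by (intro sum.mono_neutral_right) (auto simp: diagonal_mat_def)
    finally show "(D * E) $$ (i, j) = 1\<^sub>m p $$ (i, j)"
      using ij Dc(3)[of i] by (auto simp: E_def)
  qed (use Dc E in auto)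
  have LM: "L\<^sup>T * M\<^sup>T = 1\<^sub>m p"
    using transpose_mult[OF M(1) Lc] M(3) by simp
  have "L * D * L\<^sup>T * (M\<^sup>T * E * M) = L * (D * ((L\<^sup>T * M\<^sup>T) * (E * M)))"
    using Lc Dc(1) M(1) E(1) by (simp add: assoc_mult_mat[of _ p p _ p _ p])
  also have "\<dots> = L * ((D * E) * M)"
    using Lc Dc(1) M(1) E(1) LM by (simp add: assoc_mult_mat[of _ p p _ p _ p])
  also have "\<dots> = 1\<^sub>m p" using DE M by simp
  finally have inv: "mat_inv (L * D * L\<^sup>T) = M\<^sup>T * E * M"
    by (intro mat_inv_eqI[of _ p]) (use Lc Dc M E in auto)
  then show ?carrier using M E by simp
  assume ij: "i < p" "j < p"
  have "(M\<^sup>T * E * M\<^sup>T\<^sup>T) $$ (i, j) = (\<Sum>k<p. M\<^sup>T $$ (i, k) * E $$ (k, k) * M\<^sup>T $$ (j, k))"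
    using M E ij by (intro congruence_entry) auto
  then show ?entry
    unfolding inv M_def[symmetric] using M ij by (auto simp: E_def intro!: sum.cong)
qed

section \<open>Principal submatrices\<close>

lemma bij_betw_pick:
  assumes "finite T"
  shows "bij_betw (pick T) {..<card T} T"
proof (rule bij_betwI')
  show "pick T x = pick T y \<longleftrightarrow> x = y" if "x \<in> {..<card T}" "y \<in> {..<card T}" for x y
    using that pick_mono_le[of x T y] pick_mono_le[of y T x]
    by (metis lessThan_iff less_irrefl linorder_neqE_nat pick_mono_le)
  show "pick T x \<in> T" if "x \<in> {..<card T}" for x
    using that pick_in_set_le by simp
  show "\<exists>x\<in>{..<card T}. y = pick T x" if "y \<in> T" for y
  proof
    \<comment> \<open>The preimage of \<open>y\<close> is its rank in \<open>T\<close>.\<close>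
    show "y = pick T (card {a \<in> T. a < y})" using that by (simp add: pick_card_in_set)
    show "card {a \<in> T. a < y} \<in> {..<card T}"
      using assms that by (auto intro!: psubset_card_mono)
  qed
qed

lemma principal_submatrix_carrier:
  assumes "A \<in> carrier_mat p p" "T \<subseteq> {..<p}"
  shows "principal_submatrix A T \<in> carrier_mat (card T) (card T)"
proof -
  have "{i. i < p \<and> i \<in> T} = T" using assms by auto
  then show ?thesis using assms by (auto simp: submatrix_def)
qed

lemma principal_submatrix_entry:
  assumes "A \<in> carrier_mat p p" "T \<subseteq> {..<p}" "i < card T" "j < card T"
  shows "principal_submatrix A T $$ (i, j) = A $$ (pick T i, pick T j)"
proof -
  have "{i. i < p \<and> i \<in> T} = T" using assms by auto
  then show ?thesis using assms by (auto simp: submatrix_def)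
qed

text \<open>\<open>pick T\<close> is increasing, so a submatrix of a matrix that is triangular on
  \<open>T\<close> is again triangular.\<close>

lemma det_principal_submatrix_lower_triangular:
  assumes A: "A \<in> carrier_mat p p" and T: "T \<subseteq> {..<p}"
    and low: "\<And>i j. i \<in> T \<Longrightarrow> j \<in> T \<Longrightarrow> i < j \<Longrightarrow> A $$ (i, j) = 0"
  shows "det (principal_submatrix A T) = (\<Prod>i\<in>T. A $$ (i, i))"
proof -
  have "det (principal_submatrix A T) =
      (\<Prod>i<card T. principal_submatrix A T $$ (i, i))"
    using principal_submatrix_carrier[OF A T] low principal_submatrix_entry[OF A T]
    by (intro det_lower_triangular_prod) (auto simp: pick_in_set_le pick_mono_le)
  also have "\<dots> = (\<Prod>i<card T. A $$ (pick T i, pick T i))"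
    using principal_submatrix_entry[OF A T] by simp
  also have "\<dots> = (\<Prod>i\<in>T. A $$ (i, i))"
    using T finite_subset by (intro prod.reindex_bij_betw bij_betw_pick) auto
  finally show ?thesis .
qed

text \<open>Since the sum runs over \<open>T\<close> alone, the congruence restricts to the
  principal submatrices, and determinants multiply.\<close>

lemma det_principal_submatrix_congruence:
  fixes A :: "'a::comm_ring_1 mat"
  assumes A: "A \<in> carrier_mat p p" and M: "M \<in> carrier_mat p p" and T: "T \<subseteq> {..<p}"
    and entry: "\<And>i j. i \<in> T \<Longrightarrow> j \<in> T \<Longrightarrow>
      A $$ (i, j) = (\<Sum>k\<in>T. M $$ (k, i) * d k * M $$ (k, j))"
  shows "det (principal_submatrix A T) = (det (principal_submatrix M T))\<^sup>2 * (\<Prod>k\<in>T. d k)"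
proof -
  let ?m = "card T" and ?N = "principal_submatrix M T"
  define E where "E = mat ?m ?m (\<lambda>(i, j). if i = j then d (pick T i) else 0)"
  have E: "E \<in> carrier_mat ?m ?m" "diagonal_mat E" by (auto simp: E_def diagonal_mat_def)
  have N: "?N \<in> carrier_mat ?m ?m" by (rule principal_submatrix_carrier[OF M T])
  have pick: "bij_betw (pick T) {..<?m} T" using T finite_subset by (intro bij_betw_pick) auto
  have "principal_submatrix A T = ?N\<^sup>T * E * ?N\<^sup>T\<^sup>T"
  proof (rule eq_matI)
    fix i j assume "i < dim_row (?N\<^sup>T * E * ?N\<^sup>T\<^sup>T)" "j < dim_col (?N\<^sup>T * E * ?N\<^sup>T\<^sup>T)"
    then have ij: "i < ?m" "j < ?m" using N by auto
    have "principal_submatrix A T $$ (i, j) = A $$ (pick T i, pick T j)"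
      using A T ij by (rule principal_submatrix_entry)
    also have "\<dots> = (\<Sum>k\<in>T. M $$ (k, pick T i) * d k * M $$ (k, pick T j))"
      using ij pick_in_set_le by (intro entry) auto
    also have "\<dots> = (\<Sum>k<?m. M $$ (pick T k, pick T i) * d (pick T k) * M $$ (pick T k, pick T j))"
      using pick by (rule sum.reindex_bij_betw[symmetric])
    also have "\<dots> = (\<Sum>k<?m. ?N\<^sup>T $$ (i, k) * E $$ (k, k) * ?N\<^sup>T $$ (j, k))"
      using ij N principal_submatrix_entry[OF M T] by (intro sum.cong) (auto simp: E_def)
    also have "\<dots> = (?N\<^sup>T * E * ?N\<^sup>T\<^sup>T) $$ (i, j)"
      using N E ij by (intro congruence_entry[symmetric]) auto
    finally show "principal_submatrix A T $$ (i, j) = (?N\<^sup>T * E * ?N\<^sup>T\<^sup>T) $$ (i, j)" .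
  qed (use N principal_submatrix_carrier[OF A T] in auto)
  also have "det \<dots> = det ?N * det E * det ?N"
    using N E by (simp add: det_mult[of _ ?m] det_transpose[of _ ?m])
  also have "det E = (\<Prod>k\<in>T. d k)"
    using det_diagonal[OF E] prod.reindex_bij_betw[OF pick, of d] by (simp add: E_def)
  finally show ?thesis by (simp add: power2_eq_square mult_ac)
qed

section \<open>Ordered graphs\<close>

locale ordered_graph = pair_graph G for G :: "'v pair_pre_digraph" +
  fixes \<sigma> :: "'v \<Rightarrow> nat" and p :: nat
  assumes p: "p = card (pverts G)" and ordering: "vertex_ordering G \<sigma>"
begin

abbreviation adj :: "nat \<Rightarrow> nat \<Rightarrow> bool" where
  "adj \<equiv> adj_at G \<sigma>"

lemma bij_ordering: "bij_betw \<sigma> (pverts G) {..<p}"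
  using ordering by (simp add: vertex_ordering_def p)

lemma ordering_less: "v \<in> pverts G \<Longrightarrow> \<sigma> v < p"
  using bij_betw_apply[OF bij_ordering] by simp

lemma ordering_eq_iff: "u \<in> pverts G \<Longrightarrow> v \<in> pverts G \<Longrightarrow> \<sigma> u = \<sigma> v \<longleftrightarrow> u = v"
  using bij_betw_imp_inj_on[OF bij_ordering] by (auto dest: inj_onD)

lemma obtain_vertex:
  assumes "i < p"
  obtains v where "v \<in> pverts G" "\<sigma> v = i"
  using assms bij_betw_imp_surj_on[OF bij_ordering] by (metis imageE lessThan_iff)

lemma adj_ordering:
  "u \<in> pverts G \<Longrightarrow> v \<in> pverts G \<Longrightarrow> adj (\<sigma> u) (\<sigma> v) \<longleftrightarrow> (u, v) \<in> parcs G"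
  by (simp add: adj_at_def bij_betw_inv_into_left[OF bij_ordering])

lemma arc_sym: "(u, v) \<in> parcs G \<Longrightarrow> (v, u) \<in> parcs G"
  by (rule arcs_symmetric)

lemma arc_neq: "(u, v) \<in> parcs G \<Longrightarrow> u \<noteq> v"
  using pair_no_loops by fastforce

lemma arc_verts: "(u, v) \<in> parcs G \<Longrightarrow> u \<in> pverts G \<and> v \<in> pverts G"
  using arc_fst_in_verts arc_snd_in_verts by fastforce

lemma adj_sym: "adj i j \<Longrightarrow> adj j i"
  unfolding adj_at_def by (rule arc_sym)

lemma adj_neq: "adj i j \<Longrightarrow> i \<noteq> j"
  unfolding adj_at_def by (auto dest: arc_neq)

section \<open>Nestedness along the ordering and Hasse tree schemes\<close>

definition nested :: bool where
  "nested \<longleftrightarrow>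
     (\<forall>u v. (u, v) \<in> parcs G \<and> \<sigma> v < \<sigma> u \<longrightarrow> closed_nbhd G v \<subseteq> closed_nbhd G u)"

text \<open>In index form the condition splits by the position of \<open>k\<close>. For
  \<open>k < j\<close> it is transitivity of the lower triangular adjacency pattern; for
  \<open>k > j\<close> it says that later neighbours of \<open>j\<close> are pairwise adjacent, i.e.
  the ordering is a perfect elimination ordering.\<close>

lemma nested_adj:
  "nested \<longleftrightarrow> (\<forall>i<p. \<forall>j<i. \<forall>k<p. adj i j \<and> adj j k \<and> k \<noteq> i \<longrightarrow> adj i k)"
proof
  assume n: nested
  show "\<forall>i<p. \<forall>j<i. \<forall>k<p. adj i j \<and> adj j k \<and> k \<noteq> i \<longrightarrow> adj i k"
  proof (intro allI impI, elim conjE)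
    fix i j k assume *: "i < p" "j < i" "k < p" "adj i j" "adj j k" "k \<noteq> i"
    obtain u where u: "u \<in> pverts G" "\<sigma> u = i" using *(1) by (rule obtain_vertex)
    obtain v where v: "v \<in> pverts G" "\<sigma> v = j" using *(1,2) obtain_vertex[of j] by auto
    obtain w where w: "w \<in> pverts G" "\<sigma> w = k" using *(3) by (rule obtain_vertex)
    have uv: "(u, v) \<in> parcs G" and vw: "(v, w) \<in> parcs G"
      using * u v w adj_ordering by blast+
    have "w \<in> closed_nbhd G v" using vw w arc_sym by (auto simp: closed_nbhd_def)
    with n uv u v * have "w \<in> closed_nbhd G u" by (auto simp: nested_def)
    with u w * have "(w, u) \<in> parcs G" by (auto simp: closed_nbhd_def)
    then show "adj i k" using u w adj_ordering arc_sym by blast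
  qed
next
  assume *: "\<forall>i<p. \<forall>j<i. \<forall>k<p. adj i j \<and> adj j k \<and> k \<noteq> i \<longrightarrow> adj i k"
  show nested
    unfolding nested_def
  proof (intro allI impI subsetI, elim conjE)
    fix u v w assume uv: "(u, v) \<in> parcs G" "\<sigma> v < \<sigma> u" and w: "w \<in> closed_nbhd G v"
    have V: "u \<in> pverts G" "v \<in> pverts G" "w \<in> pverts G"
      using uv w arc_verts by (auto simp: closed_nbhd_def)
    consider "w = u" | "w = v" | "w \<noteq> u" "(v, w) \<in> parcs G"
      using w arc_sym by (auto simp: closed_nbhd_def)
    then show "w \<in> closed_nbhd G u"
    proof cases
      case 3
      have "adj (\<sigma> u) (\<sigma> w)"
        using *[rule_format, of "\<sigma> u" "\<sigma> v" "\<sigma> w"] 3 V uv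
        by (simp add: adj_ordering ordering_less ordering_eq_iff)
      then show ?thesis using V arc_sym by (auto simp: closed_nbhd_def adj_ordering)
    qed (use V uv arc_sym in \<open>auto simp: closed_nbhd_def\<close>)
  qed
qed

lemma nbhd_class_eqI:
  assumes "u \<in> pverts G" "v \<in> pverts G" "closed_nbhd G u = closed_nbhd G v"
  shows "nbhd_class G u = nbhd_class G v"
  using assms by (auto simp: nbhd_class_def nbhd_equiv_def above_def)

lemma closed_nbhd_eqI:
  assumes "v \<in> pverts G" "nbhd_class G u = nbhd_class G v"
  shows "closed_nbhd G u = closed_nbhd G v"
proof -
  have "v \<in> nbhd_class G u"
    using assms by (simp add: nbhd_class_def nbhd_equiv_def above_def)
  then show ?thesis by (auto simp: nbhd_class_def nbhd_equiv_def above_def)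
qed

text \<open>Homogeneity makes adjacent neighbourhoods comparable, and the scheme fixes the
  direction: an inclusion against the order would be strict, so the classes would differ and the
  order would be reversed. Conversely, nestedness against the order would turn
  \<open>above G u v\<close> into equality of classes.\<close>

theorem hasse_scheme_iff_nested:
  "homogeneous G \<and> hasse_tree_elim_scheme G \<sigma> \<longleftrightarrow> nested"
proof
  assume *: "homogeneous G \<and> hasse_tree_elim_scheme G \<sigma>"
  show nested
    unfolding nested_def
  proof (intro allI impI, elim conjE)
    fix u v assume uv: "(u, v) \<in> parcs G" "\<sigma> v < \<sigma> u"
    then have V: "u \<in> pverts G" "v \<in> pverts G" using arc_verts by auto
    show "closed_nbhd G v \<subseteq> closed_nbhd G u"
    proof (rule ccontr)
      assume no: "\<not> closed_nbhd G v \<subseteq> closed_nbhd G u"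
      with * uv have "above G v u" by (auto simp: homogeneous_def above_def)
      moreover have "nbhd_class G v \<noteq> nbhd_class G u"
        using no closed_nbhd_eqI[OF V(1)] by blast
      ultimately have "\<sigma> u < \<sigma> v" using * V by (auto simp: hasse_tree_elim_scheme_def)
      with uv show False by simp
    qed
  qed
next
  assume n: nested
  have "homogeneous G"
    unfolding homogeneous_def
  proof clarify
    fix u v x assume uv: "(u, v) \<in> parcs G"
      and x: "x \<in> closed_nbhd G u" "x \<notin> closed_nbhd G v"
    have "\<sigma> u \<noteq> \<sigma> v" using uv arc_verts arc_neq ordering_eq_iff by blast
    then show "y \<in> closed_nbhd G u" if "y \<in> closed_nbhd G v" for y
      using n uv arc_sym[OF uv] x that unfolding nested_def
      by (meson linorder_neqE_nat subsetD)
  qed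
  moreover have "hasse_tree_elim_scheme G \<sigma>"
    unfolding hasse_tree_elim_scheme_def
  proof (intro ballI impI, elim conjE)
    fix u v assume V: "u \<in> pverts G" "v \<in> pverts G" and a: "above G u v"
      and c: "nbhd_class G u \<noteq> nbhd_class G v"
    \<comment> \<open>Every vertex lies in its own closed neighbourhood, so comparable vertices of
      different classes are adjacent.\<close>
    have "v \<in> closed_nbhd G u" using a V by (auto simp: above_def closed_nbhd_def)
    with c have vu: "(v, u) \<in> parcs G" by (auto simp: closed_nbhd_def)
    show "\<sigma> v < \<sigma> u"
    proof (rule ccontr)
      assume "\<not> \<sigma> v < \<sigma> u"
      then have "\<sigma> u < \<sigma> v" using V arc_neq[OF vu] ordering_eq_iff by (metis linorder_neqE_nat)
      with n vu have "closed_nbhd G u \<subseteq> closed_nbhd G v" by (auto simp: nested_def)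
      with a have "closed_nbhd G u = closed_nbhd G v" by (auto simp: above_def)
      with V c nbhd_class_eqI show False by blast
    qed
  qed
  ultimately show "homogeneous G \<and> hasse_tree_elim_scheme G \<sigma>" ..
qed

section \<open>Zero patterns as conditions on strictly lower entries\<close>

lemma L_space_iff:
  "L \<in> L_space G \<sigma> \<longleftrightarrow> unit_lower_triangular p L \<and>
     (\<forall>i<p. \<forall>j<i. \<not> adj i j \<longrightarrow> L $$ (i, j) = 0)"
  unfolding L_space_def Let_def p mem_Collect_eq by (meson less_trans)

text \<open>Symmetry of \<open>S\<close> and of adjacency makes the upper entries redundant, so the
  same positions matter as in \<open>L_space_iff\<close>.\<close>

lemma P_cone_iff:
  "S \<in> P_cone G \<sigma> \<longleftrightarrow> sym_pos_definite p S \<and>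
     (\<forall>i<p. \<forall>j<i. \<not> adj i j \<longrightarrow> S $$ (i, j) = 0)"
proof -
  have "S $$ (i, j) = S $$ (j, i)" if "sym_pos_definite p S" "i < p" "j < p" for i j
    using that unfolding sym_pos_definite_def
    by (metis carrier_matD index_transpose_mat(1))
  moreover have "S \<in> P_cone G \<sigma> \<longleftrightarrow> sym_pos_definite p S \<and>
     (\<forall>i<p. \<forall>j<p. i \<noteq> j \<and> \<not> adj i j \<longrightarrow> S $$ (i, j) = 0)"
    unfolding P_cone_def Let_def p by simp
  ultimately show ?thesis
    by (smt (verit, best) adj_sym less_trans linorder_neqE_nat order_less_irrefl)
qed

subsection \<open>The Cholesky condition\<close>

lemma nested_L_space_inverse:
  assumes n: nested and L: "L \<in> L_space G \<sigma>"
  shows "mat_inv L \<in> L_space G \<sigma>"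
proof -
  have Lt: "unit_lower_triangular p L" and Lz: "\<And>i j. i < p \<Longrightarrow> j < i \<Longrightarrow> \<not> adj i j \<Longrightarrow> L $$ (i, j) = 0"
    using L by (auto simp: L_space_iff)
  \<comment> \<open>Transitivity is demanded over all naturals; the conjunct \<open>i < p\<close>
    makes \<open>nested_adj\<close> applicable there.\<close>
  define R where "R i j \<longleftrightarrow> i = j \<or> (j < i \<and> i < p \<and> adj i j)" for i j
  have "reflp R" by (simp add: R_def reflp_def)
  moreover have "transp R"
    unfolding transp_def R_def using n[unfolded nested_adj]
    by (metis less_trans nat_neq_iff)
  moreover have "R i j" if "i < p" "j < p" "L $$ (i, j) \<noteq> 0" for i j
    using that Lz unit_lower_triangularD(3)[OF Lt] unfolding R_def by (metis nat_neq_iff)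
  ultimately have R: "R i j" if "i < p" "j < p" "mat_inv L $$ (i, j) \<noteq> 0" for i j
    using inverse_support[OF Lt] mat_inv_unit_lower_triangular[OF Lt] that by blast
  then show ?thesis
    unfolding L_space_iff R_def
    by (metis unit_lower_triangular_mat_inv[OF Lt] less_irrefl less_trans)
qed

text \<open>At a nonadjacent pair \<open>j < i\<close>, no earlier \<open>k\<close> is adjacent to
  both, so the sum for the entry of \<open>?S\<close> collapses to
  \<open>L $$ (i, j) * D $$ (j, j)\<close>. The zeros of \<open>L\<close> and \<open>?S\<close> then
  correspond, column by column.\<close>

lemma nested_L_space_iff_P_cone:
  assumes n: nested and L: "unit_lower_triangular p L" and D: "pos_diagonal p D"
  shows "L \<in> L_space G \<sigma> \<longleftrightarrow> L * D * L\<^sup>T \<in> P_cone G \<sigma>"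
proof -
  let ?S = "L * D * L\<^sup>T"
  note Ld = unit_lower_triangularD[OF L] and Dd = pos_diagonalD[OF D]
  \<comment> \<open>Zeros of \<open>L\<close> are assumed only in columns before \<open>j\<close>,
    so that in the converse direction the induction hypothesis can supply them.\<close>
  have entry: "?S $$ (i, j) = L $$ (i, j) * D $$ (j, j)"
    if ij: "j < i" "i < p" "\<not> adj i j"
      and supp: "\<And>i k. i < p \<Longrightarrow> k < i \<Longrightarrow> k < j \<Longrightarrow> \<not> adj i k \<Longrightarrow> L $$ (i, k) = 0" for i j
  proof -
    have zero: "L $$ (i, k) * D $$ (k, k) * L $$ (j, k) = 0" if "k < p" "k \<noteq> j" for k
    proof (cases "k < j")
      case True
      then have "\<not> adj i k \<or> \<not> adj j k"
        using n[unfolded nested_adj, rule_format, of j k i] ij adj_sym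
        by (metis less_trans nat_neq_iff)
      with supp ij True show ?thesis by (metis less_trans mult_eq_0_iff)
    next
      case False
      with that have "L $$ (j, k) = 0" using Ld(3) by simp
      then show ?thesis by simp
    qed
    have "?S $$ (i, j) = (\<Sum>k<p. L $$ (i, k) * D $$ (k, k) * L $$ (j, k))"
      using ij by (intro congruence_entry[OF Ld(1) Dd(1,2)]) auto
    also have "\<dots> = (\<Sum>k\<in>{j}. L $$ (i, k) * D $$ (k, k) * L $$ (j, k))"
      using ij zero by (intro sum.mono_neutral_right) auto
    finally show ?thesis using Ld(2) ij by simp
  qed
  show ?thesis
  proof
    assume "L \<in> L_space G \<sigma>"
    then have z: "L $$ (i, j) = 0" if "i < p" "j < i" "\<not> adj i j" for i j
      using that by (auto simp: L_space_iff)
    then show "?S \<in> P_cone G \<sigma>"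
      using entry sym_pos_definite_cholesky[OF L D] by (simp add: P_cone_iff)
  next
    assume S: "?S \<in> P_cone G \<sigma>"
    have "L $$ (i, j) = 0" if "i < p" "j < i" "\<not> adj i j" for i j
      using that
    proof (induction j arbitrary: i rule: less_induct)
      case (less j)
      then have "L $$ (i, j) * D $$ (j, j) = ?S $$ (i, j)" by (intro entry[symmetric]) auto
      also have "\<dots> = 0" using S less.prems by (simp add: P_cone_iff)
      finally show ?case using Dd(3)[of j] less.prems by simp
    qed
    with L show "L \<in> L_space G \<sigma>" by (auto simp: L_space_iff)
  qed
qed

definition cholesky_condition :: bool where
  "cholesky_condition \<longleftrightarrow> (\<forall>D L. pos_diagonal p D \<and> unit_lower_triangular p L \<longrightarrow>
     (L \<in> L_space G \<sigma> \<longleftrightarrow> mat_inv L \<in> L_space G \<sigma>) \<and>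
     (mat_inv L \<in> L_space G \<sigma> \<longleftrightarrow> L * D * L\<^sup>T \<in> P_cone G \<sigma>))"

section \<open>Test matrices that detect failures of nestedness\<close>

lemma pos_diagonal_one: "pos_diagonal p (1\<^sub>m p)"
  by (auto simp: pos_diagonal_def diagonal_mat_def)

definition arc_mat :: "(nat \<times> nat) set \<Rightarrow> real mat" where
  "arc_mat X = mat p p (\<lambda>(i, j). if i = j \<or> (i, j) \<in> X then 1 else 0)"

lemma arc_mat_entry [simp]:
  "i < p \<Longrightarrow> j < p \<Longrightarrow> arc_mat X $$ (i, j) = (if i = j \<or> (i, j) \<in> X then 1 else 0)"
  by (simp add: arc_mat_def)

lemma arc_mat_L_space:
  assumes "\<And>i j. (i, j) \<in> X \<Longrightarrow> j < i \<and> adj i j"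
  shows "arc_mat X \<in> L_space G \<sigma>"
  using assms
  by (auto simp: L_space_iff unit_lower_triangular_def lower_triangular_def arc_mat_def
      dest: less_asym)

text \<open>Rows \<open>i\<close> and \<open>j\<close> of the test matrix \<open>?L\<close> share
  only column \<open>k\<close>, so \<open>?L * ?L\<^sup>T\<close> has entry 1 at
  \<open>(i, j)\<close>, which must therefore be an adjacent pair.\<close>

lemma cholesky_condition_perfect_elimination:
  assumes c: cholesky_condition and ijk: "i < p" "j < i" "k < j" and adj: "adj i k" "adj j k"
  shows "adj i j"
proof (rule ccontr)
  assume no: "\<not> adj i j"
  let ?L = "arc_mat {(i, k), (j, k)}"
  have L: "?L \<in> L_space G \<sigma>" using adj ijk by (intro arc_mat_L_space) auto
  then have Lt: "unit_lower_triangular p ?L" by (simp add: L_space_iff)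
  have "?L * 1\<^sub>m p * ?L\<^sup>T \<in> P_cone G \<sigma>"
    using c pos_diagonal_one Lt L by (auto simp: cholesky_condition_def)
  with no ijk have "0 = (?L * 1\<^sub>m p * ?L\<^sup>T) $$ (i, j)" by (simp add: P_cone_iff)
  also have "\<dots> = (\<Sum>l<p. ?L $$ (i, l) * 1\<^sub>m p $$ (l, l) * ?L $$ (j, l))"
    using ijk pos_diagonalD(1,2)[OF pos_diagonal_one] unit_lower_triangularD(1)[OF Lt]
    by (intro congruence_entry[of _ p p]) auto
  also have "\<dots> = (\<Sum>l\<in>{k}. ?L $$ (i, l) * 1\<^sub>m p $$ (l, l) * ?L $$ (j, l))"
    using ijk by (intro sum.mono_neutral_right) auto
  finally show False using ijk by simp
qed

text \<open>Inverting \<open>I + E_ij + E_jk\<close> creates the product term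
  \<open>E_ij * E_jk = E_ik\<close>, so the inverse has entry 1 at \<open>(i, k)\<close>.\<close>

lemma cholesky_condition_transitive:
  assumes c: cholesky_condition and ijk: "i < p" "j < i" "k < j" and adj: "adj i j" "adj j k"
  shows "adj i k"
proof (rule ccontr)
  assume no: "\<not> adj i k"
  let ?L = "arc_mat {(i, j), (j, k)}"
  let ?M = "mat_inv ?L"
  have L: "?L \<in> L_space G \<sigma>" using adj ijk by (intro arc_mat_L_space) auto
  then have Lt: "unit_lower_triangular p ?L" by (simp add: L_space_iff)
  note M = mat_inv_unit_lower_triangular[OF Lt]
  have prod: "(\<Sum>l<p. ?M $$ (i, l) * ?L $$ (l, m)) = 1\<^sub>m p $$ (i, m)" if "m < p" for m
    using mult_entry[OF M(1) unit_lower_triangularD(1)[OF Lt] ijk(1) that] M(3) by simp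
  \<comment> \<open>Columns \<open>k\<close> and \<open>j\<close> of row \<open>i\<close> in
    \<open>?M * ?L = 1\<close> give two equations; with the unit diagonal they force
    \<open>?M $$ (i, k) = 1\<close>.\<close>
  have "?M $$ (i, k) + ?M $$ (i, j) = (\<Sum>l\<in>{k, j}. ?M $$ (i, l) * ?L $$ (l, k))"
    using ijk by simp
  also have "\<dots> = (\<Sum>l<p. ?M $$ (i, l) * ?L $$ (l, k))"
    using ijk by (intro sum.mono_neutral_left) auto
  finally have 1: "?M $$ (i, k) + ?M $$ (i, j) = 0" using prod[of k] ijk by simp
  have "?M $$ (i, j) + ?M $$ (i, i) = (\<Sum>l\<in>{j, i}. ?M $$ (i, l) * ?L $$ (l, j))"
    using ijk by simp
  also have "\<dots> = (\<Sum>l<p. ?M $$ (i, l) * ?L $$ (l, j))"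
    using ijk by (intro sum.mono_neutral_left) auto
  finally have 2: "?M $$ (i, j) + ?M $$ (i, i) = 0" using prod[of j] ijk by simp
  have 3: "?M $$ (i, i) = 1"
    using unit_lower_triangularD(2)[OF unit_lower_triangular_mat_inv[OF Lt]] ijk by simp
  have "?M \<in> L_space G \<sigma>"
    using c pos_diagonal_one Lt L by (auto simp: cholesky_condition_def)
  with no ijk have "?M $$ (i, k) = 0" by (simp add: L_space_iff)
  with 1 2 3 show False by simp
qed

theorem nested_iff_cholesky_condition: "nested \<longleftrightarrow> cholesky_condition"
proof
  assume n: nested
  \<comment> \<open>One implication suffices, as \<open>mat_inv\<close> is an involution
    here.\<close>
  have "L \<in> L_space G \<sigma> \<longleftrightarrow> mat_inv L \<in> L_space G \<sigma>" if "unit_lower_triangular p L" for L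
    using nested_L_space_inverse[OF n] mat_inv_mat_inv[OF that] by metis
  then show cholesky_condition
    using nested_L_space_iff_P_cone[OF n] by (auto simp: cholesky_condition_def)
next
  assume c: cholesky_condition
  show nested
    unfolding nested_adj
  proof (intro allI impI, elim conjE)
    fix i j k assume *: "i < p" "j < i" "k < p" "adj i j" "adj j k" "k \<noteq> i"
    consider "k < j" | "j < k" "k < i" | "i < k"
      using * adj_neq by (meson linorder_neqE_nat)
    then show "adj i k"
    proof cases
      case 1
      then show ?thesis using cholesky_condition_transitive[OF c] * by blast
    next
      case 2
      then show ?thesis using cholesky_condition_perfect_elimination[OF c, of i k j] * adj_sym by blast
    next
      case 3
      then show ?thesis using cholesky_condition_perfect_elimination[OF c, of k i j] * adj_sym by blast
    qed
  qed
qed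

subsection \<open>The determinant condition\<close>

definition determinant_condition :: bool where
  "determinant_condition \<longleftrightarrow> (\<forall>S L D. S \<in> P_cone G \<sigma> \<and> modified_cholesky p S L D \<longrightarrow>
     (\<forall>C. maximal_clique G C \<longrightarrow>
        det (principal_submatrix (mat_inv S) (\<sigma> ` C)) = (\<Prod>i\<in>\<sigma> ` C. 1 / D $$ (i, i))))"

lemma clique_extends:
  assumes "clique G C"
  obtains C' where "maximal_clique G C'" "C \<subseteq> C'"
proof -
  have "finite {C'. clique G C'}"
    by (rule finite_subset[of _ "Pow (pverts G)"]) (auto simp: clique_def pair_finite_verts)
  then obtain C' where C': "clique G C'" "C \<subseteq> C'" "\<And>B. clique G B \<Longrightarrow> C' \<subseteq> B \<Longrightarrow> C' = B"
    using finite_has_maximal2[of "{C'. clique G C'}" C] assms by auto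
  then have "maximal_clique G C'" by (auto simp: maximal_clique_def)
  with that C'(2) show ?thesis by blast
qed

text \<open>All of \<open>C\<close> lies in \<open>N[v]\<close>, hence in \<open>N[u]\<close>, so
  \<open>u\<close> could be added to \<open>C\<close>.\<close>

lemma nested_maximal_clique_closed:
  assumes n: nested and C: "maximal_clique G C" and "v \<in> C" and uv: "(u, v) \<in> parcs G" "\<sigma> v < \<sigma> u"
  shows "u \<in> C"
proof (rule ccontr)
  assume "u \<notin> C"
  have cl: "clique G C" using C by (simp add: maximal_clique_def)
  have nb: "closed_nbhd G v \<subseteq> closed_nbhd G u" using n uv by (auto simp: nested_def)
  have "(w, u) \<in> parcs G" if "w \<in> C" for w
  proof -
    have "w \<in> closed_nbhd G v" using cl that \<open>v \<in> C\<close> by (auto simp: clique_def closed_nbhd_def)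
    with nb \<open>u \<notin> C\<close> that show ?thesis by (auto simp: closed_nbhd_def)
  qed
  then have "clique G (insert u C)"
    using cl arc_verts[OF uv(1)] arc_sym by (auto simp: clique_def)
  with C \<open>u \<notin> C\<close> show False by (auto simp: maximal_clique_def)
qed

lemma nested_imp_determinant_condition:
  assumes n: nested
  shows determinant_condition
  unfolding determinant_condition_def
proof (intro allI impI, elim conjE)
  fix S L D C assume S: "S \<in> P_cone G \<sigma>" and ch: "modified_cholesky p S L D"
    and C: "maximal_clique G C"
  have L: "unit_lower_triangular p L" and D: "pos_diagonal p D" and SL: "S = L * D * L\<^sup>T"
    using ch by (auto simp: modified_cholesky_def)
  let ?T = "\<sigma> ` C" and ?M = "mat_inv L"
  have CV: "C \<subseteq> pverts G" using C by (simp add: maximal_clique_def clique_def)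
  then have T: "?T \<subseteq> {..<p}" using ordering_less by auto
  have "?M \<in> L_space G \<sigma>"
    using nested_L_space_inverse[OF n] nested_L_space_iff_P_cone[OF n L D] S SL by simp
  then have Mz: "?M $$ (i, j) = 0" if "i < p" "j < i" "\<not> adj i j" for i j
    using that by (simp add: L_space_iff)
  note Mt = unit_lower_triangular_mat_inv[OF L]
  \<comment> \<open>Rows above \<open>c\<close> vanish by triangularity. A later \<open>k\<close>
    outside the clique is not adjacent to \<open>c\<close>, since maximal cliques are closed under
    later neighbours.\<close>
  have zero: "?M $$ (k, c) = 0" if k: "k < p" "k \<notin> ?T" and c: "c \<in> ?T" for k c
  proof -
    obtain u where u: "u \<in> pverts G" "\<sigma> u = k" using k(1) by (rule obtain_vertex)
    obtain v where v: "v \<in> C" "\<sigma> v = c" using c by auto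
    have "u \<notin> C" using k u by auto
    then have "\<not> (c < k \<and> adj k c)"
      using nested_maximal_clique_closed[OF n C v(1), of u] u v CV adj_ordering by blast
    moreover have "c \<noteq> k" using k c by auto
    ultimately show ?thesis
      using Mz[OF k(1)] unit_lower_triangularD(3)[OF Mt] T c by (meson lessThan_iff nat_neq_iff subsetD)
  qed
  have entry: "mat_inv S $$ (i, j) = (\<Sum>k\<in>?T. ?M $$ (k, i) * (1 / D $$ (k, k)) * ?M $$ (k, j))"
    if "i \<in> ?T" "j \<in> ?T" for i j
  proof -
    have "mat_inv S $$ (i, j) = (\<Sum>k<p. ?M $$ (k, i) * (1 / D $$ (k, k)) * ?M $$ (k, j))"
      unfolding SL using that T by (intro mat_inv_cholesky_entry[OF L D]) auto
    also have "\<dots> = (\<Sum>k\<in>?T. ?M $$ (k, i) * (1 / D $$ (k, k)) * ?M $$ (k, j))"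
      using T zero that by (intro sum.mono_neutral_right) auto
    finally show ?thesis .
  qed
  have Sc: "mat_inv S \<in> carrier_mat p p"
    unfolding SL by (rule mat_inv_cholesky_carrier[OF L D])
  have "det (principal_submatrix ?M ?T) = (\<Prod>i\<in>?T. ?M $$ (i, i))"
    using unit_lower_triangularD[OF Mt] T by (intro det_principal_submatrix_lower_triangular) auto
  also have "\<dots> = 1"
    using unit_lower_triangularD(2)[OF Mt] T by (intro prod.neutral) auto
  finally show "det (principal_submatrix (mat_inv S) ?T) = (\<Prod>i\<in>?T. 1 / D $$ (i, i))"
    using det_principal_submatrix_congruence[OF Sc unit_lower_triangularD(1)[OF Mt] T entry] by simp
qed

text \<open>For \<open>L = I + E\<^sub>i\<^sub>j\<close> and \<open>D = I\<close>, the inverse of \<open>LDL\<^sup>T\<close> is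
  \<open>I - E\<^sub>i\<^sub>j - E\<^sub>j\<^sub>i + E\<^sub>j\<^sub>j\<close>, so a maximal clique through \<open>j\<close> that misses \<open>i\<close> yields determinant 2.\<close>

lemma determinant_condition_imp_nested:
  assumes d: determinant_condition
  shows nested
  unfolding nested_def
proof (intro allI impI subsetI, elim conjE)
  fix u v w assume uv: "(u, v) \<in> parcs G" "\<sigma> v < \<sigma> u" and w: "w \<in> closed_nbhd G v"
  have V: "u \<in> pverts G" "v \<in> pverts G" "w \<in> pverts G"
    using uv w arc_verts by (auto simp: closed_nbhd_def)
  show "w \<in> closed_nbhd G u"
  proof (rule ccontr)
    assume no: "w \<notin> closed_nbhd G u"
    have "clique G {v, w}"
      using V w arc_sym by (auto simp: clique_def closed_nbhd_def)
    then obtain C where C: "maximal_clique G C" "{v, w} \<subseteq> C" by (rule clique_extends)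
    have cl: "clique G C" using C by (simp add: maximal_clique_def)
    \<comment> \<open>\<open>C\<close> contains \<open>w\<close>, which is neither equal nor
      adjacent to \<open>u\<close>.\<close>
    have "u \<notin> C" using cl C(2) no V by (auto simp: clique_def closed_nbhd_def)
    define i j where "i = \<sigma> u" and "j = \<sigma> v"
    have ij: "i < p" "j < i" "adj i j"
      using V uv ordering_less by (auto simp: i_def j_def adj_ordering)
    let ?T = "\<sigma> ` C"
    have CV: "C \<subseteq> pverts G" using cl by (simp add: clique_def)
    then have T: "?T \<subseteq> {..<p}" using ordering_less by auto
    have iT: "i \<notin> ?T" using \<open>u \<notin> C\<close> V CV ordering_eq_iff by (auto simp: i_def)
    have jT: "j \<in> ?T" using C(2) by (auto simp: j_def)
    \<comment> \<open>This elementary matrix is \<open>I + E_ij\<close>; its inverse flips the sign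
      of the off-diagonal entry.\<close>
    define L :: "real mat" where "L = addrow_mat p 1 i j"
    let ?S = "L * 1\<^sub>m p * L\<^sup>T"
    have L: "unit_lower_triangular p L"
      using ij by (auto simp: L_def unit_lower_triangular_def lower_triangular_def)
    have "L * addrow_mat p (- 1) i j = 1\<^sub>m p"
      using addrow_mat_inv[of i p j 1] ij by (simp add: L_def)
    then have M: "mat_inv L = addrow_mat p (- 1) i j"
      by (intro mat_inv_eqI[of _ p]) (auto simp: L_def)
    \<comment> \<open>The only nonzero strictly lower entry of \<open>?S\<close> sits at
      \<open>(i, j)\<close>, an adjacent pair.\<close>
    have "?S $$ (a, b) = 0" if ab: "a < p" "b < a" "\<not> adj a b" for a b
    proof -
      have "?S $$ (a, b) = (\<Sum>k<p. L $$ (a, k) * 1\<^sub>m p $$ (k, k) * L $$ (b, k))"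
        using ab pos_diagonalD(1,2)[OF pos_diagonal_one] unit_lower_triangularD(1)[OF L]
        by (intro congruence_entry[of _ p p]) auto
      also have "\<dots> = 0"
        using ab ij by (intro sum.neutral) (auto simp: L_def)
      finally show ?thesis .
    qed
    then have "?S \<in> P_cone G \<sigma>"
      using sym_pos_definite_cholesky[OF L pos_diagonal_one] by (simp add: P_cone_iff)
    moreover have "modified_cholesky p ?S L (1\<^sub>m p)"
      using L pos_diagonal_one by (simp add: modified_cholesky_def)
    ultimately have "det (principal_submatrix (mat_inv ?S) ?T) = (\<Prod>a\<in>?T. 1 / 1\<^sub>m p $$ (a, a))"
      using d C(1) unfolding determinant_condition_def by blast
    also have "\<dots> = 1" using T by (intro prod.neutral) auto
    finally have det1: "det (principal_submatrix (mat_inv ?S) ?T) = 1" .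
    have entry: "mat_inv ?S $$ (a, b) = (if a = b then if a = j then 2 else 1 else 0)"
      if ab: "a \<in> ?T" "b \<in> ?T" for a b
    proof -
      have less: "a < p" "b < p" and neq: "a \<noteq> i" "b \<noteq> i" using ab T iT by auto
      have "mat_inv ?S $$ (a, b) =
          (\<Sum>k<p. mat_inv L $$ (k, a) * (1 / 1\<^sub>m p $$ (k, k)) * mat_inv L $$ (k, b))"
        using less by (intro mat_inv_cholesky_entry[OF L pos_diagonal_one])
      \<comment> \<open>Column \<open>a\<close> of the inverse of \<open>L\<close> is supported in
        rows \<open>a\<close> and \<open>i\<close>. Row \<open>i\<close>, outside the clique,
        contributes the extra 1 at \<open>a = b = j\<close>.\<close>
      also have "\<dots> = (\<Sum>k\<in>{a, i}. mat_inv L $$ (k, a) * (1 / 1\<^sub>m p $$ (k, k)) * mat_inv L $$ (k, b))"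
        using less ij by (intro sum.mono_neutral_right) (auto simp: M)
      also have "\<dots> = (if a = b then if a = j then 2 else 1 else 0)"
        using less neq ij by (auto simp: M)
      finally show ?thesis .
    qed
    have "det (principal_submatrix (mat_inv ?S) ?T) = (\<Prod>a\<in>?T. mat_inv ?S $$ (a, a))"
      using mat_inv_cholesky_carrier[OF L pos_diagonal_one] T entry
      by (intro det_principal_submatrix_lower_triangular) auto
    also have "\<dots> = (\<Prod>a\<in>?T. if a = j then 2 else 1)"
      using entry by (intro prod.cong) auto
    also have "\<dots> = 2"
      using jT T finite_subset[OF T] by (simp add: prod.delta)
    finally show False using det1 by simp
  qed
qed

end

theorem theorem1:
  fixes G :: "'v pair_pre_digraph" and \<sigma> :: "'v \<Rightarrow> nat" and p :: nat
  assumes "pair_graph G"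
    and "p = card (pverts G)"
    and "vertex_ordering G \<sigma>"
  shows "let
      stmt1 = (homogeneous G \<and> hasse_tree_elim_scheme G \<sigma>);
      stmt2 = (\<forall>D L. pos_diagonal p D \<and> unit_lower_triangular p L \<longrightarrow>
         (L \<in> L_space G \<sigma> \<longleftrightarrow> mat_inv L \<in> L_space G \<sigma>) \<and>
         (mat_inv L \<in> L_space G \<sigma> \<longleftrightarrow> L * D * L\<^sup>T \<in> P_cone G \<sigma>));
      stmt3 = (\<forall>S L D. S \<in> P_cone G \<sigma> \<and> modified_cholesky p S L D \<longrightarrow>
         (\<forall>C. maximal_clique G C \<longrightarrow>
            det (principal_submatrix (mat_inv S) (\<sigma> ` C)) = (\<Prod>i\<in>\<sigma> ` C. 1 / D $$ (i, i))))
    in (stmt1 \<longleftrightarrow> stmt2) \<and> (stmt2 \<longleftrightarrow> stmt3)"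
proof -
  interpret pair_graph G by fact
  interpret ordered_graph G \<sigma> p by unfold_locales fact+
  \<comment> \<open>Unfolding turns statement 1 into \<open>nested\<close> and then into statement
    2; this equivalence links statement 3.\<close>
  have "determinant_condition \<longleftrightarrow> nested"
    using nested_imp_determinant_condition determinant_condition_imp_nested by blast
  then show ?thesis
    unfolding Let_def cholesky_condition_def[symmetric] determinant_condition_def[symmetric]
      hasse_scheme_iff_nested nested_iff_cholesky_condition by blast
qed

end
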